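(* Let $q\geq 2$ and $n\geq 2$ be integers. The map $d\colon(\mathbb{R}^q)^n\to\mathbb{R}_+$ that carries $(x_1,\ldots,x_n)$ into the diameter of a largest inner ball associated with $x_1,\ldots,x_n$ is an $n$-distance on $\mathbb{R}^q$.
   Context: $\mathbb{R}_+=[0,+\infty[$. For a set $X$ with at least two elements and an integer $n\geq 2$, an $n$-distance on $X$ is a map $d\colon X^n\to\mathbb{R}_+$ such that: (i) $d(x_1,\ldots,x_n)=0$ if and only if $x_1=\cdots=x_n$; (ii) $d$ is invariant under any permutation of its arguments; (iii) (simplex inequality) $d(x_1,\ldots,x_n)\leq\sum_{i=1}^n d(x_1,\ldots,x_n)_i^z$ for all $x_1,\ldots,x_n,z\in X$, where $d(x_1,\ldots,x_n)_i^z$ denotes the value obtained from $d(x_1,\ldots,x_n)$ by replacing its $i$th argument by $z$. A (closed) Euclidean $q$-ball of radius $r>0$ centered at $c\in\mathbb{R}^q$ is $\{x\in\mathbb{R}^q:|x-c|\leq r\}$, where $|\cdot|$ is the Euclidean norm. Given points $x_1,\ldots,x_n\in\mathbb{R}^q$, a Euclidean $q$-ball $B$ is an inner ball associated with $x_1,\ldots,x_n$ if: (1) the interior of $B$ contains none of the points $x_1,\ldots,x_n$; and (2) two of the points $x_1,\ldots,x_n$ are the endpoints of a diameter of $B$. When $x_1=\cdots=x_n$, there is no such ball and $d(x_1,\ldots,x_n)=0$ by convention. *)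

theory Defs
  imports "HOL-Analysis.Analysis"
begin

text \<open>An element of \<open>X\<^sup>n\<close> is a list of length \<open>n\<close> with entries in \<open>X\<close>, and a map on \<open>X\<^sup>n\<close>
  is a function on lists of which only the values on those lists matter.\<close>

definition tuples :: "nat \<Rightarrow> 'a set \<Rightarrow> 'a list set" where
  "tuples n X = {xs. set xs \<subseteq> X \<and> length xs = n}"

definition all_equal :: "'a list \<Rightarrow> bool" where
  "all_equal xs \<longleftrightarrow> (\<forall>x\<in>set xs. \<forall>y\<in>set xs. x = y)"

definition n_distance :: "nat \<Rightarrow> 'a set \<Rightarrow> ('a list \<Rightarrow> real) \<Rightarrow> bool" where
  "n_distance n X d \<longleftrightarrow>
     2 \<le> n \<and> (\<exists>x\<in>X. \<exists>y\<in>X. x \<noteq> y) \<and>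
     (\<forall>xs\<in>tuples n X. 0 \<le> d xs) \<and>
     (\<forall>xs\<in>tuples n X. d xs = 0 \<longleftrightarrow> all_equal xs) \<and>
     (\<forall>xs\<in>tuples n X. \<forall>\<pi>. \<pi> permutes {..<n} \<longrightarrow> d (permute_list \<pi> xs) = d xs) \<and>
     (\<forall>xs\<in>tuples n X. \<forall>z\<in>X. d xs \<le> (\<Sum>i<n. d (xs[i := z])))"

definition endpoints_of_diameter :: "'a::euclidean_space \<Rightarrow> real \<Rightarrow> 'a \<Rightarrow> 'a \<Rightarrow> bool" where
  "endpoints_of_diameter c r x y \<longleftrightarrow> x \<in> sphere c r \<and> y \<in> sphere c r \<and> c = midpoint x y"

text \<open>The indices \<open>i\<close> and \<open>j\<close> select two of the points by position, so that the list may have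
  repeated entries.\<close>

definition inner_ball :: "'a::euclidean_space list \<Rightarrow> 'a set \<Rightarrow> bool" where
  "inner_ball xs B \<longleftrightarrow>
     (\<exists>c r. 0 < r \<and> B = cball c r \<and>
        (\<forall>x\<in>set xs. x \<notin> interior B) \<and>
        (\<exists>i<length xs. \<exists>j<length xs. i \<noteq> j \<and> endpoints_of_diameter c r (xs ! i) (xs ! j)))"

text \<open>A largest inner ball maximizes the diameter (equivalently the radius). It need not be
  unique, but its diameter is; it exists by \<open>largest_inner_ball_exists\<close> below, so that the
  choice made by \<open>ARG_MAX\<close> is a genuine one.\<close>

definition inner_ball_dist :: "'a::euclidean_space list \<Rightarrow> real" where
  "inner_ball_dist xs = (if all_equal xs then 0 else diameter (ARG_MAX diameter B. inner_ball xs B))"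

lemma finite_inner_balls: "finite {B. inner_ball xs B}"
proof (rule finite_subset)
  show "{B. inner_ball xs B} \<subseteq>
      (\<lambda>(x, y). cball (midpoint x y) (dist x (midpoint x y))) ` (set xs \<times> set xs)"
  proof
    fix B assume "B \<in> {B. inner_ball xs B}"
    then obtain c r i j where B: "B = cball c r" "i < length xs" "j < length xs"
      "xs ! i \<in> sphere c r" "c = midpoint (xs ! i) (xs ! j)"
      by (auto simp: inner_ball_def endpoints_of_diameter_def)
    then have "B = (\<lambda>(x, y). cball (midpoint x y) (dist x (midpoint x y))) (xs ! i, xs ! j)"
      by (simp add: dist_commute)
    moreover have "(xs ! i, xs ! j) \<in> set xs \<times> set xs"
      using B by simp
    ultimately show "B \<in> (\<lambda>(x, y). cball (midpoint x y) (dist x (midpoint x y))) ` (set xs \<times> set xs)"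
      by (rule image_eqI)
  qed
qed simp

lemma inner_ball_exists:
  assumes "\<not> all_equal xs"
  shows "\<exists>B. inner_ball xs B"
proof -
  define P where "P = {p \<in> set xs \<times> set xs. fst p \<noteq> snd p}"
  have fin: "finite P"
    unfolding P_def by simp
  have ne: "P \<noteq> {}"
    using assms by (force simp: P_def all_equal_def)
  obtain p where p: "p \<in> P" and min: "\<And>s. s \<in> P \<Longrightarrow> \<not> dist (fst s) (snd s) < dist (fst p) (snd p)"
    using ex_is_arg_min_if_finite[OF fin ne, of "\<lambda>s. dist (fst s) (snd s)"]
    by (auto simp: is_arg_min_def)
  obtain x y where xy: "p = (x, y)" by (cases p)
  have x: "x \<in> set xs" and y: "y \<in> set xs" and neq: "x \<noteq> y"
    using p by (auto simp: P_def xy)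
  define c where "c = midpoint x y"
  define r where "r = dist x y / 2"
  have r: "0 < r" using neq by (simp add: r_def)
  have dx: "dist c x = r" and dy: "dist c y = r"
    by (simp_all add: c_def r_def dist_midpoint)
  have out: "z \<notin> interior (cball c r)" if z: "z \<in> set xs" for z
  proof
    assume "z \<in> interior (cball c r)"
    then have zr: "dist c z < r" by simp
    then have "z \<noteq> x" using dx by auto
    then have "(z, x) \<in> P" using z x by (simp add: P_def)
    then have "dist x y \<le> dist z x" using min[of "(z, x)"] by (simp add: xy)
    moreover have "dist z x \<le> dist c z + dist c x"
      by (metis dist_commute dist_triangle)
    ultimately show False using zr dx by (simp add: r_def)
  qed
  obtain i where i: "i < length xs" "xs ! i = x" using x by (meson in_set_conv_nth)
  obtain j where j: "j < length xs" "xs ! j = y" using y by (meson in_set_conv_nth)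
  have "endpoints_of_diameter c r (xs ! i) (xs ! j)"
    using dx dy i j by (simp add: endpoints_of_diameter_def c_def)
  moreover have "i \<noteq> j" using i j neq by auto
  ultimately have "inner_ball xs (cball c r)"
    unfolding inner_ball_def using r out i(1) j(1) by blast
  then show ?thesis ..
qed

lemma largest_inner_ball_exists:
  assumes "\<not> all_equal xs"
  shows "is_arg_max diameter (inner_ball xs) (ARG_MAX diameter B. inner_ball xs B)"
proof -
  have "\<exists>B. is_arg_min (\<lambda>B. - diameter B) (\<lambda>B. B \<in> {B. inner_ball xs B}) B"
    using inner_ball_exists[OF assms] by (intro ex_is_arg_min_if_finite finite_inner_balls) auto
  then have "\<exists>B. is_arg_max diameter (inner_ball xs) B"
    by (simp add: is_arg_min_def is_arg_max_def)
  then show ?thesis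
    unfolding arg_max_def by (rule someI_ex)
qed

end

theory Submission
  imports Defs
begin

text \<open>Write \<open>d\<close> for \<open>inner_ball_dist\<close> and let \<open>S\<close> be the set of entries of a list \<open>xs\<close> of length
  \<open>n\<close>. The inner balls are the balls whose diameter is an edge of the Gabriel graph of \<open>S\<close>, so
  \<open>d xs\<close> is the length of a longest edge of that graph when the entries are not all equal. In
  particular it is then positive and depends on \<open>S\<close> only. Two facts give the simplex inequality.

  First, \<open>d xs\<close> is itself a distance between two entries.

  Second, no two entries are further apart than \<open>(n - 1) * d xs\<close>. Indeed, if \<open>S\<close> is split
  into two nonempty parts, then a closest pair of points in different parts is a Gabriel edge
  (lemma \<open>closest_across_cut_gabriel_edge\<close>), so the gap between the parts is at most \<open>d xs\<close>.
  Starting from one point, all of \<open>S\<close> is therefore reached in at most \<open>n - 1\<close> steps, none of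
  them longer than \<open>d xs\<close> (lemmas \<open>dist_le_of_small_gaps\<close> and \<open>dist_le_inner_ball_dist\<close>).

  Now let \<open>d xs = dist x y\<close>, where \<open>x\<close> and \<open>y\<close> are the entries at
  positions \<open>i \<noteq> j\<close>. Replacing an entry at one of the \<open>n - 2\<close> other positions by \<open>z\<close> keeps
  \<open>x\<close> and \<open>y\<close>, so by the second fact such a term is at least \<open>dist x y / (n - 1)\<close>. The terms
  at \<open>i\<close> and \<open>j\<close> are at least \<open>dist z y / (n - 1)\<close> and \<open>dist z x / (n - 1)\<close>, and the triangle
  inequality bounds their sum below by one more \<open>dist x y / (n - 1)\<close>. The total is at least
  \<open>dist x y\<close>.\<close>

definition gabriel_edge :: "'a::euclidean_space set \<Rightarrow> 'a \<Rightarrow> 'a \<Rightarrow> bool" where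
  "gabriel_edge S x y \<longleftrightarrow>
     x \<in> S \<and> y \<in> S \<and> x \<noteq> y \<and> (\<forall>w\<in>S. dist x y / 2 \<le> dist (midpoint x y) w)"

text \<open>Since inner balls have positive radius, the endpoints of the diameter are distinct points;
  hence their positions in the list are immaterial.\<close>

lemma inner_ball_iff_gabriel_edge:
  "inner_ball xs B \<longleftrightarrow>
     (\<exists>x y. gabriel_edge (set xs) x y \<and> B = cball (midpoint x y) (dist x y / 2))"
proof
  assume "inner_ball xs B"
  then obtain c r i j where r: "0 < r" "B = cball c r"
    and out: "\<forall>x\<in>set xs. x \<notin> interior B"
    and ij: "i < length xs" "j < length xs"
    and ends: "endpoints_of_diameter c r (xs ! i) (xs ! j)"
    by (auto simp: inner_ball_def)
  from ends have c: "c = midpoint (xs ! i) (xs ! j)" and "dist c (xs ! i) = r"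
    by (auto simp: endpoints_of_diameter_def)
  then have rd: "r = dist (xs ! i) (xs ! j) / 2"
    by (simp add: dist_midpoint)
  then have "gabriel_edge (set xs) (xs ! i) (xs ! j)"
    using r out ij c by (auto simp: gabriel_edge_def not_less)
  then show "\<exists>x y. gabriel_edge (set xs) x y \<and> B = cball (midpoint x y) (dist x y / 2)"
    using r c rd by blast
next
  assume "\<exists>x y. gabriel_edge (set xs) x y \<and> B = cball (midpoint x y) (dist x y / 2)"
  then obtain x y where g: "gabriel_edge (set xs) x y"
    and B: "B = cball (midpoint x y) (dist x y / 2)" by blast
  obtain i j where i: "i < length xs" "xs ! i = x" and j: "j < length xs" "xs ! j = y"
    using g by (auto simp: gabriel_edge_def in_set_conv_nth)
  moreover have "i \<noteq> j"
    using i j g by (auto simp: gabriel_edge_def)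
  moreover have "endpoints_of_diameter (midpoint x y) (dist x y / 2) x y"
    by (simp add: endpoints_of_diameter_def dist_midpoint)
  moreover have "0 < dist x y / 2" "\<forall>w\<in>set xs. w \<notin> interior B"
    using g B by (auto simp: gabriel_edge_def not_less)
  ultimately show "inner_ball xs B"
    unfolding inner_ball_def using B by blast
qed

lemma inner_ball_dist_cong_set:
  assumes "set xs = set ys"
  shows "inner_ball_dist xs = inner_ball_dist ys"
proof -
  have "inner_ball xs = inner_ball ys"
    using assms by (simp add: fun_eq_iff inner_ball_iff_gabriel_edge)
  then show ?thesis
    using assms by (simp add: inner_ball_dist_def all_equal_def)
qed

lemma diameter_gabriel_ball:
  assumes "gabriel_edge S x y"
  shows "diameter (cball (midpoint x y) (dist x y / 2)) = dist x y"
  using assms by (simp add: gabriel_edge_def)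

lemma inner_ball_dist_eq_gabriel_edge:
  assumes "\<not> all_equal xs"
  obtains x y where "gabriel_edge (set xs) x y" "inner_ball_dist xs = dist x y"
proof -
  have "inner_ball xs (ARG_MAX diameter B. inner_ball xs B)"
    using largest_inner_ball_exists[OF assms] by (simp add: is_arg_max_def)
  then obtain x y where g: "gabriel_edge (set xs) x y"
    and B: "(ARG_MAX diameter B. inner_ball xs B) = cball (midpoint x y) (dist x y / 2)"
    using inner_ball_iff_gabriel_edge by blast
  show thesis
    using that[OF g] assms diameter_gabriel_ball[OF g] by (simp add: inner_ball_dist_def B)
qed

lemma gabriel_edge_le_inner_ball_dist:
  assumes g: "gabriel_edge (set xs) x y"
  shows "dist x y \<le> inner_ball_dist xs"
proof -
  have ne: "\<not> all_equal xs"
    using g by (auto simp: gabriel_edge_def all_equal_def)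
  have "inner_ball xs (cball (midpoint x y) (dist x y / 2))"
    using g inner_ball_iff_gabriel_edge by blast
  then have "diameter (cball (midpoint x y) (dist x y / 2))
      \<le> diameter (ARG_MAX diameter B. inner_ball xs B)"
    using largest_inner_ball_exists[OF ne] unfolding is_arg_max_linorder by blast
  then show ?thesis
    unfolding diameter_gabriel_ball[OF g] using ne by (simp add: inner_ball_dist_def)
qed

lemma inner_ball_dist_all_equal: "all_equal xs \<Longrightarrow> inner_ball_dist xs = 0"
  by (simp add: inner_ball_dist_def)

lemma inner_ball_dist_pos: "\<not> all_equal xs \<Longrightarrow> 0 < inner_ball_dist xs"
  by (erule inner_ball_dist_eq_gabriel_edge) (simp add: gabriel_edge_def)

lemma inner_ball_dist_nonneg: "0 \<le> inner_ball_dist xs"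
  using inner_ball_dist_all_equal[of xs] inner_ball_dist_pos[of xs] by fastforce

text \<open>A point strictly inside the ball with diameter \<open>a\<close>, \<open>b\<close> is closer to both \<open>a\<close> and \<open>b\<close> than
  these are to each other. Whichever part it belongs to, it would form a shorter pair across the
  cut with the endpoint in the other part.\<close>

lemma closest_across_cut_gabriel_edge:
  fixes A B :: "'a::euclidean_space set"
  assumes "a \<in> A" "b \<in> B" and disj: "A \<inter> B = {}"
    and closest: "\<And>u v. u \<in> A \<Longrightarrow> v \<in> B \<Longrightarrow> dist a b \<le> dist u v"
  shows "gabriel_edge (A \<union> B) a b"
proof -
  have "dist a b / 2 \<le> dist (midpoint a b) w" if w: "w \<in> A \<union> B" for w
  proof -
    have "dist w b \<le> dist (midpoint a b) w + dist a b / 2"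
      using dist_triangle[of w b "midpoint a b"] by (simp add: dist_midpoint dist_commute)
    moreover have "dist a w \<le> dist (midpoint a b) w + dist a b / 2"
      using dist_triangle[of a w "midpoint a b"] by (simp add: dist_midpoint)
    moreover have "dist a b \<le> dist w b \<or> dist a b \<le> dist a w"
      using w closest assms(1,2) by blast
    ultimately show ?thesis by linarith
  qed
  then show ?thesis
    using assms(1,2) disj by (auto simp: gabriel_edge_def)
qed

lemma cut_gap_le_inner_ball_dist:
  assumes "A \<union> B = set xs" "A \<inter> B = {}" "A \<noteq> {}" "B \<noteq> {}"
  shows "\<exists>a\<in>A. \<exists>b\<in>B. dist a b \<le> inner_ball_dist xs"
proof -
  have "finite (A \<times> B)"
    by (metis assms(1) List.finite_set finite_Un finite_cartesian_product)
  moreover have "A \<times> B \<noteq> {}"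
    using assms by simp
  ultimately obtain p where "is_arg_min (\<lambda>p. dist (fst p) (snd p)) (\<lambda>p. p \<in> A \<times> B) p"
    using ex_is_arg_min_if_finite by blast
  then obtain a b where ab: "a \<in> A" "b \<in> B"
    and closest: "\<And>u v. u \<in> A \<Longrightarrow> v \<in> B \<Longrightarrow> dist a b \<le> dist u v"
    by (fastforce simp: is_arg_min_linorder)
  have "gabriel_edge (set xs) a b"
    using closest_across_cut_gabriel_edge[OF ab assms(2) closest] assms(1) by simp
  then show ?thesis
    using gabriel_edge_le_inner_ball_dist ab by blast
qed

text \<open>Instead of a path from \<open>x\<close> to \<open>y\<close>, the proof grows a set around \<open>x\<close> by one point at a time:
  each new point is within \<open>\<delta>\<close> of an old one, so \<open>k + 1\<close> points can be collected within distance
  \<open>k * \<delta>\<close> of \<open>x\<close>.\<close>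

lemma dist_le_of_small_gaps:
  fixes S :: "'a::metric_space set"
  assumes "finite S" "x \<in> S" "y \<in> S"
    and gap: "\<And>A. A \<subset> S \<Longrightarrow> A \<noteq> {} \<Longrightarrow> \<exists>a\<in>A. \<exists>b\<in>S - A. dist a b \<le> \<delta>"
  shows "dist x y \<le> real (card S - 1) * \<delta>"
proof -
  have grow: "\<exists>A\<subseteq>S. card A = Suc k \<and> (\<forall>a\<in>A. dist x a \<le> real k * \<delta>)" if "k < card S" for k
    using that
  proof (induction k)
    case 0
    show ?case
      using \<open>x \<in> S\<close> by (intro exI[of _ "{x}"]) auto
  next
    case (Suc k)
    then obtain A where A: "A \<subseteq> S" "card A = Suc k" "\<forall>a\<in>A. dist x a \<le> real k * \<delta>"
      by auto
    have "A \<subset> S" "A \<noteq> {}"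
      using A Suc.prems by auto
    then obtain a b where ab: "a \<in> A" "b \<in> S - A" "dist a b \<le> \<delta>"
      using gap by blast
    have "dist x b \<le> real (Suc k) * \<delta>"
      using A(3) ab dist_triangle[of x b a] by (fastforce simp: algebra_simps)
    moreover have "0 \<le> \<delta>"
      using ab(3) zero_le_dist[of a b] by linarith
    then have "dist x a' \<le> real (Suc k) * \<delta>" if "a' \<in> A" for a'
      using A(3) that by (fastforce simp: algebra_simps)
    moreover have "card (insert b A) = Suc (Suc k)"
      using A ab finite_subset[OF A(1) \<open>finite S\<close>] by simp
    ultimately show ?case
      using A(1) ab(2) by (intro exI[of _ "insert b A"]) auto
  qed
  have "0 < card S"
    using assms by (auto simp: card_gt_0_iff)
  then obtain A where A: "A \<subseteq> S" "card A = card S" "\<forall>a\<in>A. dist x a \<le> real (card S - 1) * \<delta>"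
    using grow[of "card S - 1"] by auto
  then have "A = S"
    using \<open>finite S\<close> card_subset_eq by blast
  then show ?thesis
    using A \<open>y \<in> S\<close> by blast
qed

lemma dist_le_inner_ball_dist:
  assumes "x \<in> set xs" "y \<in> set xs"
  shows "dist x y \<le> real (length xs - 1) * inner_ball_dist xs"
proof -
  have "dist x y \<le> real (card (set xs) - 1) * inner_ball_dist xs"
  proof (rule dist_le_of_small_gaps[OF _ assms])
    fix A assume "A \<subset> set xs" "A \<noteq> {}"
    then show "\<exists>a\<in>A. \<exists>b\<in>set xs - A. dist a b \<le> inner_ball_dist xs"
      by (intro cut_gap_le_inner_ball_dist) auto
  qed simp
  also have "\<dots> \<le> real (length xs - 1) * inner_ball_dist xs"
    by (intro mult_right_mono inner_ball_dist_nonneg) (simp add: card_length diff_le_mono)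
  finally show ?thesis .
qed

lemma inner_ball_dist_simplex:
  fixes z :: "'a::euclidean_space"
  assumes n: "length xs = n" "2 \<le> n"
  shows "inner_ball_dist xs \<le> (\<Sum>k<n. inner_ball_dist (xs[k := z]))"
proof (cases "all_equal xs")
  case True
  then show ?thesis
    by (simp add: inner_ball_dist_all_equal inner_ball_dist_nonneg sum_nonneg)
next
  case False
  then obtain x y where g: "gabriel_edge (set xs) x y" and d: "inner_ball_dist xs = dist x y"
    by (rule inner_ball_dist_eq_gabriel_edge)
  then obtain i j where i: "i < n" "xs ! i = x" and j: "j < n" "xs ! j = y"
    using n by (auto simp: gabriel_edge_def in_set_conv_nth)
  have "i \<noteq> j"
    using g i j by (auto simp: gabriel_edge_def)
  define m where "m = real (n - 1)"
  have bound: "dist (ys ! a) (ys ! b) \<le> m * inner_ball_dist ys"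
    if "a < n" "b < n" "length ys = n" for ys :: "'a list" and a b
    using dist_le_inner_ball_dist[of "ys ! a" ys "ys ! b"] that by (simp add: m_def)
  have others: "dist x y \<le> m * inner_ball_dist (xs[k := z])" if "k \<noteq> i" "k \<noteq> j" for k
    using bound[of i j "xs[k := z]"] that i j n by simp
  have at_i: "dist z y \<le> m * inner_ball_dist (xs[i := z])"
    using bound[of i j "xs[i := z]"] \<open>i \<noteq> j\<close> i j n by simp
  have at_j: "dist x z \<le> m * inner_ball_dist (xs[j := z])"
    using bound[of i j "xs[j := z]"] \<open>i \<noteq> j\<close> i j n by simp
  let ?R = "{..<n} - {i} - {j}"
  have "card ?R = n - 2"
    using i j \<open>i \<noteq> j\<close> by simp
  then have "m * dist x y = dist x y + (\<Sum>k\<in>?R. dist x y)"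
    using n by (simp add: m_def of_nat_diff algebra_simps)
  also have "\<dots> \<le> (dist z y + dist x z) + (\<Sum>k\<in>?R. m * inner_ball_dist (xs[k := z]))"
    using dist_triangle[of x y z] others by (intro add_mono sum_mono) auto
  also have "\<dots> \<le> m * inner_ball_dist (xs[i := z]) + (m * inner_ball_dist (xs[j := z])
      + (\<Sum>k\<in>?R. m * inner_ball_dist (xs[k := z])))"
    using at_i at_j by linarith
  also have "\<dots> = (\<Sum>k<n. m * inner_ball_dist (xs[k := z]))"
    using i j \<open>i \<noteq> j\<close> by (simp add: sum.remove[of "{..<n}" i] sum.remove[of "{..<n} - {i}" j])
  also have "\<dots> = m * (\<Sum>k<n. inner_ball_dist (xs[k := z]))"
    by (simp add: sum_distrib_left)
  finally have "m * dist x y \<le> m * (\<Sum>k<n. inner_ball_dist (xs[k := z]))" .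
  moreover have "0 < m"
    using n by (simp add: m_def)
  ultimately show ?thesis
    by (simp add: d)
qed

theorem proposition3p4:
  fixes n :: nat
  assumes "2 \<le> CARD('q::finite)" and "2 \<le> n"
  shows "n_distance n (UNIV :: (real ^ 'q) set) inner_ball_dist"
  unfolding n_distance_def
proof (intro conjI ballI allI impI)
  show "2 \<le> n" by fact
  show "\<exists>x\<in>UNIV. \<exists>y\<in>(UNIV :: (real ^ 'q) set). x \<noteq> y"
    using zero_neq_one by blast
next
  fix xs :: "(real ^ 'q) list" assume "xs \<in> tuples n UNIV"
  then have len: "length xs = n"
    by (simp add: tuples_def)
  show "0 \<le> inner_ball_dist xs"
    by (rule inner_ball_dist_nonneg)
  show "inner_ball_dist xs = 0 \<longleftrightarrow> all_equal xs"
    using inner_ball_dist_all_equal[of xs] inner_ball_dist_pos[of xs] by fastforce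
  show "inner_ball_dist (permute_list \<pi> xs) = inner_ball_dist xs" if "\<pi> permutes {..<n}" for \<pi>
    using that len by (intro inner_ball_dist_cong_set set_permute_list) simp
  show "inner_ball_dist xs \<le> (\<Sum>i<n. inner_ball_dist (xs[i := z]))" for z
    using inner_ball_dist_simplex len \<open>2 \<le> n\<close> by blast
qed

end
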